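(* Let $0\le i<j\le d-1$ be integers. Every $d$-polytope is weakly $(i,j)$-scribable.
   Context: Let $\mathbb S^d=\{x\in\mathbb R^{d+1}:\|x\|_2=1\}$, with coordinates $x_0,\dots,x_d$. A spherical polytope is an intersection of finitely many closed hemispheres of $\mathbb S^d$ containing no two antipodal points; equivalently, $\mathcal P=\mathcal K\cap\mathbb S^d$ for a pointed polyhedral cone $\mathcal K\subset\mathbb R^{d+1}$. Its $k$-faces are the intersections with $\mathbb S^d$ of the $(k+1)$-dimensional faces of $\mathcal K$. A $d$-polytope is a polytope of dimension $d$. Every Euclidean $d$-polytope has the same face lattice as some spherical $d$-polytope and conversely. A realization of a combinatorial type of $d$-polytope is a spherical $d$-polytope in $\mathbb S^d$ with isomorphic face lattice. Let $\mathcal B=\{x\in\mathbb S^d: x_0\ge 0,\ -x_0^2+x_1^2+\dots+x_d^2\le 0\}$ (a spherical cap), $\mathcal S=\partial\mathcal B$ and $\operatorname{int}\mathcal B=\mathcal B\setminus\mathcal S$. For a face $F$, $\operatorname{Span}(F)$ denotes its spherical span, i.e. the intersection of the linear span of $F$ with $\mathbb S^d$. A proper face $F$ weakly cuts $\mathcal S$ if $\operatorname{Span}(F)\cap\mathcal B\neq\emptyset$, and weakly avoids $\mathcal S$ if $\operatorname{Span}(F)\cap\operatorname{int}\mathcal B=\emptyset$. For $0\le i\le j\le d-1$, a spherical $d$-polytope is weakly $(i,j)$-scribed if every $i$-face weakly avoids $\mathcal S$ and every $j$-face weakly cuts $\mathcal S$. A (combinatorial type of) $d$-polytope is weakly $(i,j)$-scribable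 if it has a weakly $(i,j)$-scribed realization. *)

theory Defs
  imports "HOL-Analysis.Analysis"
begin

definition closed_hemisphere :: "'a::euclidean_space set \<Rightarrow> bool" where
  "closed_hemisphere H \<longleftrightarrow> (\<exists>a. a \<noteq> 0 \<and> H = {x \<in> sphere 0 1. a \<bullet> x \<ge> 0})"

definition spherical_polytope :: "'a::euclidean_space set \<Rightarrow> bool" where
  "spherical_polytope P \<longleftrightarrow>
     (\<exists>\<H>. finite \<H> \<and> (\<forall>H\<in>\<H>. closed_hemisphere H) \<and> P = sphere 0 1 \<inter> \<Inter>\<H>) \<and>
     (\<forall>x\<in>P. - x \<notin> P)"

(* The polyhedral cone K with P = K \<inter> sphere 0 1.  The apex is inserted because
   the library's cone hull of the empty set is empty. *)
definition polytope_cone :: "'a::euclidean_space set \<Rightarrow> 'a set" where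
  "polytope_cone P = insert 0 (cone hull P)"

(* The constant dim is the dimension of the linear span, which is one more than the
   spherical dimension. *)
definition spherical_d_polytope :: "nat \<Rightarrow> 'a::euclidean_space set \<Rightarrow> bool" where
  "spherical_d_polytope d P \<longleftrightarrow> spherical_polytope P \<and> dim (polytope_cone P) = d + 1"

definition k_face :: "nat \<Rightarrow> 'a::euclidean_space set \<Rightarrow> 'a set \<Rightarrow> bool" where
  "k_face k F P \<longleftrightarrow>
     (\<exists>G. G face_of polytope_cone P \<and> dim G = k + 1 \<and> F = G \<inter> sphere 0 1)"

(* Includes the empty face, cut out by the apex {0}, and P itself. *)
definition spherical_faces :: "'a::euclidean_space set \<Rightarrow> 'a set set" where
  "spherical_faces P = {G \<inter> sphere 0 1 | G. G face_of polytope_cone P}"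

definition isomorphic_face_lattices ::
    "'a::euclidean_space set \<Rightarrow> 'b::euclidean_space set \<Rightarrow> bool" where
  "isomorphic_face_lattices P Q \<longleftrightarrow>
     (\<exists>\<phi>. bij_betw \<phi> (spherical_faces P) (spherical_faces Q) \<and>
          (\<forall>F\<in>spherical_faces P. \<forall>G\<in>spherical_faces P. F \<subseteq> G \<longleftrightarrow> \<phi> F \<subseteq> \<phi> G))"

(* With d = CARD('d), the ambient space of dimension d + 1 is real \<times> (real^'d):
   fst x is the coordinate x_0 and the entries of snd x are x_1, ..., x_d. *)
definition cap :: "(real \<times> (real^'d::finite)) set" where
  "cap = {x \<in> sphere 0 1. fst x \<ge> 0 \<and> - (fst x)\<^sup>2 + (\<Sum>k\<in>UNIV. (snd x $ k)\<^sup>2) \<le> 0}"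

(* The boundary is taken relative to the unit sphere. *)
definition cap_boundary :: "(real \<times> (real^'d::finite)) set" where
  "cap_boundary = top_of_set (sphere 0 1) frontier_of cap"

definition cap_interior :: "(real \<times> (real^'d::finite)) set" where
  "cap_interior = cap - cap_boundary"

definition spherical_span :: "'a::euclidean_space set \<Rightarrow> 'a set" where
  "spherical_span F = span F \<inter> sphere 0 1"

definition weakly_cuts :: "(real \<times> (real^'d::finite)) set \<Rightarrow> bool" where
  "weakly_cuts F \<longleftrightarrow> spherical_span F \<inter> cap \<noteq> {}"

definition weakly_avoids :: "(real \<times> (real^'d::finite)) set \<Rightarrow> bool" where
  "weakly_avoids F \<longleftrightarrow> spherical_span F \<inter> cap_interior = {}"

definition weakly_scribed :: "nat \<Rightarrow> nat \<Rightarrow> (real \<times> (real^'d::finite)) set \<Rightarrow> bool" where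
  "weakly_scribed i j P \<longleftrightarrow>
     (\<forall>F. k_face i F P \<longrightarrow> weakly_avoids F) \<and> (\<forall>F. k_face j F P \<longrightarrow> weakly_cuts F)"

definition realization ::
    "(real \<times> (real^'d::finite)) set \<Rightarrow> 'a::euclidean_space set \<Rightarrow> bool" where
  "realization Q P \<longleftrightarrow> spherical_d_polytope CARD('d) Q \<and> isomorphic_face_lattices P Q"

(* The type argument fixes the sphere in which realizations live; it is meant for
   polytopes P of dimension CARD('d), in a sphere of any dimension. *)
definition weakly_scribable ::
    "'d::finite itself \<Rightarrow> nat \<Rightarrow> nat \<Rightarrow> 'a::euclidean_space set \<Rightarrow> bool" where
  "weakly_scribable d i j P \<longleftrightarrow>
     (\<exists>Q :: (real \<times> (real^'d)) set. realization Q P \<and> weakly_scribed i j Q)"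

end

theory Submission
  imports Defs
begin

text \<open>Linear isomorphisms preserve the faces of a cone, so it suffices to choose good linear
  coordinates on the span \<open>V\<close> of the cone \<open>K\<close> over the polytope. In the
  new coordinates the light cone \<open>norm (snd x) \<le> \<bar>fst x\<bar>\<close>, the double
  cone over the cap, should meet the span of every \<open>i\<close>-face only in 0 and the span of
  every \<open>j\<close>-face in a nonzero vector.

  A generic subspace \<open>E\<close> of codimension \<open>j\<close> in \<open>V\<close> already
  distinguishes the two kinds of spans: it meets a span of dimension \<open>i + 1 \<le> j\<close>
  trivially and one of dimension \<open>j + 1\<close> in a line. There are finitely many faces, so
  one \<open>E\<close> serves them all (\<open>exists_generic_hyperplanes\<close>). Coordinates in
  which the light cone is a thin neighbourhood of most of \<open>E\<close> then do what is wanted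
  (\<open>exists_linear_map_separating_dimensions\<close>): compactness keeps the thin cone off the
  small spans, while a chosen nonzero vector of \<open>E\<close> in each larger span lies inside it.
  Pulling \<open>K\<close> back along the inverse of the coordinate map gives the realization
  (\<open>isomorphic_face_lattices_vimage\<close>).\<close>

section \<open>Generic hyperplane sections and the separating linear map\<close>

lemma exists_nonorthogonal:
  fixes W :: "'a::euclidean_space set"
  assumes "finite W" "0 \<notin> W"
  obtains v where "\<And>w. w \<in> W \<Longrightarrow> v \<bullet> w \<noteq> 0"
proof -
  have "negligible (\<Union>w\<in>W. {x. w \<bullet> x = 0})"
    using assms by (intro negligible_Union) (auto intro!: negligible_hyperplane)
  then have "(\<Union>w\<in>W. {x. w \<bullet> x = 0}) \<noteq> UNIV"
    using non_negligible_UNIV by metis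
  then obtain v where "\<And>w. w \<in> W \<Longrightarrow> w \<bullet> v \<noteq> 0"
    by blast
  then show thesis
    by (intro that[of v]) (simp add: inner_commute)
qed

lemma dim_hyperplane_section_ge:
  fixes L :: "'a::euclidean_space set"
  assumes "subspace L"
  shows "dim L \<le> Suc (dim (L \<inter> {x. v \<bullet> x = 0}))"
proof -
  let ?H = "{x. v \<bullet> x = 0}"
  have "DIM('a) \<le> Suc (dim ?H)"
    by (cases "v = 0") (simp_all add: dim_hyperplane)
  moreover have "dim {x + y |x y. x \<in> L \<and> y \<in> ?H} + dim (L \<inter> ?H) = dim L + dim ?H"
    using assms subspace_hyperplane by (rule dim_sums_Int)
  moreover have "dim {x + y |x y. x \<in> L \<and> y \<in> ?H} \<le> DIM('a)"
    by (rule dim_subset_UNIV)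
  ultimately show ?thesis by linarith
qed

lemma dim_hyperplane_section:
  fixes L :: "'a::euclidean_space set"
  assumes "subspace L" "w \<in> L" "v \<bullet> w \<noteq> 0"
  shows "dim (L \<inter> {x. v \<bullet> x = 0}) = dim L - 1"
proof -
  let ?H = "{x. v \<bullet> x = 0}"
  have "subspace (L \<inter> ?H)"
    using assms(1) subspace_hyperplane by (rule subspace_inter)
  moreover have "L \<inter> ?H \<noteq> L"
    using assms by blast
  ultimately have "\<not> dim L \<le> dim (L \<inter> ?H)"
    using subspace_dim_equal[OF _ assms(1)] by blast
  with dim_hyperplane_section_ge[OF assms(1), of v] show ?thesis
    by linarith
qed

text \<open>Hyperplanes are added one at a time, each missing a nonzero vector of every section that
  is not yet trivial. Truncated subtraction covers sections that have already shrunk to 0. All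
  prefixes of one sequence are controlled because both the first \<open>j\<close> functionals and
  all \<open>CARD('d)\<close> of them are used later.\<close>

lemma exists_generic_hyperplanes:
  fixes \<L> :: "'a::euclidean_space set set"
  assumes "finite \<L>" "\<And>L. L \<in> \<L> \<Longrightarrow> subspace L"
  shows "\<exists>a :: nat \<Rightarrow> 'a. \<forall>k\<le>n. \<forall>L\<in>\<L>. dim (L \<inter> {x. \<forall>m<k. a m \<bullet> x = 0}) = dim L - k"
proof (induction n)
  case 0
  show ?case by simp
next
  case (Suc n)
  then obtain a :: "nat \<Rightarrow> 'a"
    where a: "\<And>k L. k \<le> n \<Longrightarrow> L \<in> \<L> \<Longrightarrow> dim (L \<inter> {x. \<forall>m<k. a m \<bullet> x = 0}) = dim L - k"
    by blast
  define cut where "cut L = L \<inter> {x. \<forall>m<n. a m \<bullet> x = 0}" for L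
  have sub: "subspace (cut L)" if "L \<in> \<L>" for L
    using assms(2)[OF that] unfolding cut_def subspace_def
    by (simp add: inner_add_right inner_scaleR_right)
  \<comment> \<open>One vector per section suffices to force a drop in dimension; it is 0 only where
    the section is trivial.\<close>
  have "\<exists>w. w \<in> cut L \<and> (cut L \<subseteq> {0} \<or> w \<noteq> 0)" if "L \<in> \<L>" for L
    using subspace_0[OF sub[OF that]] by blast
  then obtain w where w: "\<And>L. L \<in> \<L> \<Longrightarrow> w L \<in> cut L"
    "\<And>L. L \<in> \<L> \<Longrightarrow> cut L \<subseteq> {0} \<or> w L \<noteq> 0"
    by metis
  obtain v where v: "\<And>x. x \<in> w ` \<L> - {0} \<Longrightarrow> v \<bullet> x \<noteq> 0"
    using exists_nonorthogonal[of "w ` \<L> - {0}"] assms(1) by blast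
  have step: "dim (cut L \<inter> {x. v \<bullet> x = 0}) = dim (cut L) - 1" if "L \<in> \<L>" for L
  proof (cases "cut L \<subseteq> {0}")
    case True
    then have "dim (cut L) = 0" "dim (cut L \<inter> {x. v \<bullet> x = 0}) = 0"
      by (auto simp: dim_eq_0)
    then show ?thesis by (metis diff_0_eq_0)
  next
    case False
    with w(2)[OF that] v that show ?thesis
      by (intro dim_hyperplane_section[OF sub[OF that] w(1)[OF that]]) auto
  qed
  have "dim (L \<inter> {x. \<forall>m<k. (a(n := v)) m \<bullet> x = 0}) = dim L - k"
    if k: "k \<le> Suc n" and L: "L \<in> \<L>" for k L
  proof (cases "k \<le> n")
    case True
    then have "{x. \<forall>m<k. (a(n := v)) m \<bullet> x = 0} = {x. \<forall>m<k. a m \<bullet> x = 0}"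
      by auto
    with a[OF True L] show ?thesis by simp
  next
    case False
    with k have k: "k = Suc n" by simp
    have "L \<inter> {x. \<forall>m<k. (a(n := v)) m \<bullet> x = 0} = cut L \<inter> {x. v \<bullet> x = 0}"
      unfolding k cut_def by (auto simp: less_Suc_eq)
    with step[OF L] a[OF order_refl L] k show ?thesis
      by (simp add: cut_def)
  qed
  then show ?case by blast
qed

text \<open>The linear map stretches \<open>j\<close> generic functionals by \<open>1 / \<epsilon>\<close> and shrinks the remaining ones by
  \<open>\<epsilon>\<close>. For small \<open>\<epsilon>\<close>, the preimage of the light cone is a thin neighbourhood of a large part of the
  common kernel \<open>E\<close> of the stretched functionals. Since \<open>E\<close> has codimension \<open>j\<close>, it meets a given
  subspace nontrivially exactly if the dimension of that subspace exceeds \<open>j\<close>. Applied to the spans of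
  the faces of the cone, this puts the \<open>i\<close>-faces (span of dimension \<open>i + 1 \<le> j\<close>) and the \<open>j\<close>-faces (span of
  dimension \<open>j + 1\<close>) on different sides of the threshold.\<close>

lemma exists_linear_map_separating_dimensions:
  fixes \<L> :: "'a::euclidean_space set set"
  assumes fin: "finite \<L>" and sub: "\<And>L. L \<in> \<L> \<Longrightarrow> subspace L"
    and V: "V \<in> \<L>" "dim V = CARD('d::finite) + 1" and j: "j \<le> CARD('d)"
  obtains T :: "'a \<Rightarrow> real \<times> (real^'d)"
  where "linear T" "inj_on T V"
    "\<forall>L\<in>\<L>. dim L \<le> j \<longrightarrow> (\<forall>x\<in>L. x \<noteq> 0 \<longrightarrow> \<bar>fst (T x)\<bar> < norm (snd (T x)))"
    "\<forall>L\<in>\<L>. j < dim L \<longrightarrow> (\<exists>x\<in>L. x \<noteq> 0 \<and> norm (snd (T x)) \<le> \<bar>fst (T x)\<bar>)"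
proof -
  obtain a :: "nat \<Rightarrow> 'a" where a: "\<And>k L. k \<le> CARD('d) \<Longrightarrow> L \<in> \<L> \<Longrightarrow>
      dim (L \<inter> {x. \<forall>m<k. a m \<bullet> x = 0}) = dim L - k"
    using exists_generic_hyperplanes[OF fin sub] by blast
  obtain h :: "'d \<Rightarrow> nat" where "bij_betw h UNIV {0..<CARD('d)}"
    using ex_bij_betw_finite_nat[of "UNIV :: 'd set"] by auto
  then have h_lt: "\<And>k. h k < CARD('d)" and h_surj: "\<And>m. m < CARD('d) \<Longrightarrow> \<exists>k. h k = m"
    by (auto dest: bij_betwE, metis atLeastLessThan_iff bij_betw_imp_surj_on imageE le0)
  \<comment> \<open>\<open>g\<close> collects the functionals to be stretched, so its kernel is
    \<open>E\<close>; \<open>r\<close> collects all of them.\<close>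
  define g :: "'a \<Rightarrow> real^'d" where "g x = (\<chi> k. if h k < j then a (h k) \<bullet> x else 0)" for x
  define r :: "'a \<Rightarrow> real^'d" where "r x = (\<chi> k. a (h k) \<bullet> x)" for x
  have g_0: "g x = 0 \<longleftrightarrow> (\<forall>m<j. a m \<bullet> x = 0)" for x
  proof -
    have "g x = 0 \<longleftrightarrow> (\<forall>k. h k < j \<longrightarrow> a (h k) \<bullet> x = 0)"
      by (simp add: g_def vec_eq_iff)
    then show ?thesis
      using h_surj j by (metis order_less_le_trans)
  qed
  have r_0: "r x = 0 \<longleftrightarrow> (\<forall>m<CARD('d). a m \<bullet> x = 0)" for x
  proof -
    have "r x = 0 \<longleftrightarrow> (\<forall>k. a (h k) \<bullet> x = 0)"
      by (simp add: r_def vec_eq_iff)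
    then show ?thesis
      using h_surj h_lt by metis
  qed
  have lin_g: "linear g"
    by (rule linearI) (simp_all add: g_def vec_eq_iff inner_add_right inner_scaleR_right)
  have "\<exists>x. x \<in> L \<and> x \<noteq> 0 \<and> g x = 0" if "L \<in> \<L>" "j < dim L" for L
  proof -
    have "dim (L \<inter> {x. \<forall>m<j. a m \<bullet> x = 0}) \<noteq> 0"
      using a[OF j that(1)] that(2) by simp
    then show ?thesis
      unfolding dim_eq_0 g_0 by blast
  qed
  then obtain w where w: "\<And>L. L \<in> \<L> \<Longrightarrow> j < dim L \<Longrightarrow> w L \<in> L \<and> w L \<noteq> 0 \<and> g (w L) = 0"
    by metis
  \<comment> \<open>The functionals in \<open>r\<close> leave a line in \<open>V\<close>, spanned by
    \<open>p\<close> below. A further functional \<open>u\<close> with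
    \<open>u \<bullet> p \<noteq> 0\<close> therefore completes them to coordinates on
    \<open>V\<close>.\<close>
  have dim_K: "dim (V \<inter> {x. r x = 0}) = 1"
    using a[OF order_refl V(1)] V(2) by (simp add: r_0)
  have sub_K: "subspace (V \<inter> {x. r x = 0})"
    using sub[OF V(1)] unfolding subspace_def r_0
    by (simp add: inner_add_right inner_scaleR_right)
  obtain p where p: "p \<in> V" "r p = 0" "p \<noteq> 0"
    using dim_K dim_eq_0[of "V \<inter> {x. r x = 0}"] by auto
  \<comment> \<open>Nonvanishing at \<open>p\<close> gives injectivity; nonvanishing at each
    \<open>w L\<close> lets the first coordinate dominate there.\<close>
  let ?W = "insert p (w ` {L \<in> \<L>. j < dim L})"
  have "finite ?W" "0 \<notin> ?W"
    using fin w p by auto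
  then obtain u where u: "\<And>x. x \<in> ?W \<Longrightarrow> u \<bullet> x \<noteq> 0"
    using exists_nonorthogonal by metis
  have inj_aux: "x = 0" if "x \<in> V" "r x = 0" "u \<bullet> x = 0" for x
  proof -
    have "dim (V \<inter> {x. r x = 0} \<inter> {x. u \<bullet> x = 0}) = 0"
      using dim_hyperplane_section[OF sub_K, of p u] p u dim_K by simp
    with that show ?thesis
      unfolding dim_eq_0 by blast
  qed
  \<comment> \<open>On a subspace meeting \<open>E\<close> trivially, \<open>g\<close> is injective
    and hence bounded below.\<close>
  have ex_e: "\<exists>e>0. \<forall>x\<in>L. e * norm x \<le> norm (g x)" if "L \<in> \<L>" "dim L \<le> j" for L
  proof -
    have "dim (L \<inter> {x. g x = 0}) = 0"
      using a[OF j that(1)] that(2) by (simp add: g_0)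
    then have "\<forall>x\<in>L. g x = 0 \<longrightarrow> x = 0"
      unfolding dim_eq_0 by blast
    then show ?thesis
      using sub[OF that(1)] lin_g
      by (intro injective_imp_isometric closed_subspace) (simp_all add: linear_conv_bounded_linear)
  qed
  then obtain e where e: "\<And>L. L \<in> \<L> \<Longrightarrow> dim L \<le> j \<Longrightarrow> e L > 0"
    "\<And>L x. L \<in> \<L> \<Longrightarrow> dim L \<le> j \<Longrightarrow> x \<in> L \<Longrightarrow> e L * norm x \<le> norm (g x)"
    by metis
  have small: "eventually (\<lambda>\<epsilon>. \<epsilon> * c < b) (at_right 0)" if "b > 0" for b c :: real
  proof -
    have "((\<lambda>\<epsilon>. \<epsilon> * c) \<longlongrightarrow> 0) (at_right 0)"
      by (auto intro!: tendsto_eq_intros)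
    with that show ?thesis
      by (rule order_tendstoD(2)[rotated])
  qed
  \<comment> \<open>The first condition on \<open>\<epsilon>\<close> makes the stretched coordinates
    exceed \<open>u\<close> on small subspaces; the second makes the shrunk coordinates of each
    \<open>w L\<close> smaller than \<open>u \<bullet> w L\<close>.\<close>
  have "eventually (\<lambda>\<epsilon>. \<forall>L\<in>{L\<in>\<L>. dim L \<le> j}. \<epsilon> * norm u < e L) (at_right 0)"
    using fin e(1) by (intro eventually_ball_finite ballI small) simp_all
  moreover have "eventually (\<lambda>\<epsilon>. \<forall>L\<in>{L\<in>\<L>. j < dim L}. \<epsilon> * norm (r (w L)) < \<bar>u \<bullet> w L\<bar>) (at_right 0)"
    using fin u by (intro eventually_ball_finite ballI small) simp_all
  moreover have "eventually (\<lambda>\<epsilon>::real. \<epsilon> > 0) (at_right 0)"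
    by (rule eventually_at_right_less)
  ultimately have "eventually (\<lambda>\<epsilon>. \<epsilon> > 0 \<and> (\<forall>L\<in>{L\<in>\<L>. dim L \<le> j}. \<epsilon> * norm u < e L) \<and>
      (\<forall>L\<in>{L\<in>\<L>. j < dim L}. \<epsilon> * norm (r (w L)) < \<bar>u \<bullet> w L\<bar>)) (at_right 0)"
    by (intro eventually_conj)
  then obtain \<epsilon> :: real where \<epsilon>: "\<epsilon> > 0"
    "\<And>L. L \<in> \<L> \<Longrightarrow> dim L \<le> j \<Longrightarrow> \<epsilon> * norm u < e L"
    "\<And>L. L \<in> \<L> \<Longrightarrow> j < dim L \<Longrightarrow> \<epsilon> * norm (r (w L)) < \<bar>u \<bullet> w L\<bar>"
    using eventually_happens'[OF trivial_limit_at_right_real[of 0]] by blast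
  define T :: "'a \<Rightarrow> real \<times> (real^'d)" where
    "T x = (u \<bullet> x, \<chi> k. (if h k < j then 1 / \<epsilon> else \<epsilon>) * (a (h k) \<bullet> x))" for x
  show thesis
  proof
    show lin: "linear T"
      by (rule linearI)
        (simp_all add: T_def vec_eq_iff inner_add_right inner_scaleR_right distrib_left)
    show "inj_on T V"
    proof (subst linear_inj_on_iff_eq_0[OF lin sub[OF V(1)]], safe)
      fix x assume x: "x \<in> V" "T x = 0"
      then have "u \<bullet> x = 0" and eq: "(if h k < j then 1 / \<epsilon> else \<epsilon>) * (a (h k) \<bullet> x) = 0" for k
        by (simp_all add: T_def vec_eq_iff zero_prod_def)
      have "a (h k) \<bullet> x = 0" for k
        using eq[of k] \<epsilon>(1) by (cases "h k < j") simp_all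
      then have "r x = 0"
        by (simp add: r_def vec_eq_iff)
      with x(1) \<open>u \<bullet> x = 0\<close> show "x = 0"
        by (intro inj_aux)
    qed
    show "\<forall>L\<in>\<L>. j < dim L \<longrightarrow> (\<exists>x\<in>L. x \<noteq> 0 \<and> norm (snd (T x)) \<le> \<bar>fst (T x)\<bar>)"
    proof (intro ballI impI)
      fix L assume L: "L \<in> \<L>" and that: "j < dim L"
      \<comment> \<open>The vector \<open>w L\<close> lies in \<open>E\<close>, so only its shrunk
        coordinates survive.\<close>
      have "a (h k) \<bullet> w L = 0" if "h k < j" for k
        using w[OF L \<open>j < dim L\<close>] that by (simp add: g_0)
      then have "snd (T (w L)) = \<epsilon> *\<^sub>R r (w L)"
        by (auto simp: T_def r_def vec_eq_iff)
      with \<epsilon>(1) \<epsilon>(3)[OF L that] have "norm (snd (T (w L))) \<le> \<bar>fst (T (w L))\<bar>"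
        by (simp add: T_def)
      with w[OF L that] show "\<exists>x\<in>L. x \<noteq> 0 \<and> norm (snd (T x)) \<le> \<bar>fst (T x)\<bar>"
        by blast
    qed
    show "\<forall>L\<in>\<L>. dim L \<le> j \<longrightarrow> (\<forall>x\<in>L. x \<noteq> 0 \<longrightarrow> \<bar>fst (T x)\<bar> < norm (snd (T x)))"
    proof (intro ballI impI)
      fix L x assume L: "L \<in> \<L>" and x: "dim L \<le> j" "x \<in> L" "x \<noteq> 0"
      have "norm u < e L / \<epsilon>"
        using \<epsilon>(1) \<epsilon>(2)[OF L x(1)] by (simp add: pos_less_divide_eq mult.commute)
      then have less: "norm u * norm x < e L / \<epsilon> * norm x"
        using x(3) by (intro mult_strict_right_mono) simp_all
      have "\<bar>u \<bullet> x\<bar> \<le> norm u * norm x"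
        by (rule Cauchy_Schwarz_ineq2)
      also note less
      also have "e L / \<epsilon> * norm x = (e L * norm x) / \<epsilon>"
        by simp
      also have "\<dots> \<le> norm (g x) / \<epsilon>"
        using e(2)[OF L x(1,2)] \<epsilon>(1) by (simp add: divide_right_mono)
      also have "\<dots> = norm ((1 / \<epsilon>) *\<^sub>R g x)"
        using \<epsilon>(1) by simp
      \<comment> \<open>Discarding the shrunk coordinates can only decrease the norm.\<close>
      also have "\<dots> \<le> norm (snd (T x))"
        using \<epsilon>(1) by (intro norm_le_componentwise_cart) (auto simp: T_def g_def)
      finally show "\<bar>fst (T x)\<bar> < norm (snd (T x))"
        by (simp add: T_def)
    qed
  qed
qed

section \<open>Spherical polytopes and their cones under linear maps\<close>

lemma conic_normalize:
  fixes K :: "'a::real_normed_vector set"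
  assumes "conic K" "x \<in> K" "x \<noteq> 0"
  shows "x /\<^sub>R norm x \<in> K \<inter> sphere 0 1"
  using assms(3) conicD[OF assms(1,2), of "inverse (norm x)"] by simp

lemma polytope_cone_conic:
  fixes K :: "'a::euclidean_space set"
  assumes "conic K" "0 \<in> K"
  shows "polytope_cone (K \<inter> sphere 0 1) = K"
proof
  show "polytope_cone (K \<inter> sphere 0 1) \<subseteq> K"
    using assms by (auto simp: polytope_cone_def cone_hull_expl conic_def)
  show "K \<subseteq> polytope_cone (K \<inter> sphere 0 1)"
  proof
    fix x assume x: "x \<in> K"
    show "x \<in> polytope_cone (K \<inter> sphere 0 1)"
    proof (cases "x = 0")
      case False
      then have "x = norm x *\<^sub>R (x /\<^sub>R norm x)" "x /\<^sub>R norm x \<in> K \<inter> sphere 0 1"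
        using conic_normalize[OF assms(1) x] by simp_all
      then have "\<exists>c y. x = c *\<^sub>R y \<and> 0 \<le> c \<and> y \<in> K \<inter> sphere 0 1"
        using norm_ge_zero by blast
      then show ?thesis
        unfolding polytope_cone_def cone_hull_expl by blast
    qed (simp add: polytope_cone_def)
  qed
qed

lemma conic_linear_vimage:
  assumes "linear f" "conic K"
  shows "conic (f -` K)"
  unfolding conic_def by (simp add: linear_cmul[OF assms(1)] conicD[OF assms(2)])

lemma conic_halfspaces: "conic {x. \<forall>a\<in>A. 0 \<le> a \<bullet> x}"
  by (auto simp: conic_def)

lemma spherical_polytope_iff:
  fixes P :: "'a::euclidean_space set"
  shows "spherical_polytope P \<longleftrightarrow>
    (\<exists>A. finite A \<and> P = {x. \<forall>a\<in>A. 0 \<le> a \<bullet> x} \<inter> sphere 0 1) \<and> (\<forall>x\<in>P. - x \<notin> P)"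
proof -
  have "(\<exists>\<H>. finite \<H> \<and> (\<forall>H\<in>\<H>. closed_hemisphere H) \<and> P = sphere 0 1 \<inter> \<Inter>\<H>) \<longleftrightarrow>
    (\<exists>A. finite A \<and> P = {x. \<forall>a\<in>A. 0 \<le> a \<bullet> x} \<inter> sphere 0 1)" (is "?l \<longleftrightarrow> ?r")
  proof
    assume ?l
    then obtain \<H> where \<H>: "finite \<H>" "\<forall>H\<in>\<H>. closed_hemisphere H" "P = sphere 0 1 \<inter> \<Inter>\<H>"
      by blast
    then have "\<forall>H\<in>\<H>. \<exists>a. H = {x \<in> sphere 0 1. a \<bullet> x \<ge> 0}"
      unfolding closed_hemisphere_def by blast
    then obtain a where "\<forall>H\<in>\<H>. H = {x \<in> sphere 0 1. a H \<bullet> x \<ge> 0}"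
      by (rule bchoice[THEN exE])
    then have mem: "x \<in> H \<longleftrightarrow> x \<in> sphere 0 1 \<and> 0 \<le> a H \<bullet> x" if "H \<in> \<H>" for H x
      using that by blast
    have "P = {x. \<forall>b\<in>a ` \<H>. 0 \<le> b \<bullet> x} \<inter> sphere 0 1"
      unfolding \<H>(3) by (rule set_eqI) (simp add: mem conj_commute cong: conj_cong)
    with \<H>(1) show ?r by blast
  next
    assume ?r
    then obtain A where A: "finite A" "P = {x. \<forall>a\<in>A. 0 \<le> a \<bullet> x} \<inter> sphere 0 1"
      by blast
    let ?\<H> = "(\<lambda>a. {x \<in> sphere 0 1. a \<bullet> x \<ge> 0}) ` (A - {0})"
    have "finite ?\<H>" "\<forall>H\<in>?\<H>. closed_hemisphere H"
      using A(1) by (auto simp: closed_hemisphere_def)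
    moreover have "P = sphere 0 1 \<inter> \<Inter>?\<H>"
      unfolding A(2) by force
    ultimately show ?l by blast
  qed
  then show ?thesis
    by (simp add: spherical_polytope_def)
qed

lemma span_conic_Int_sphere:
  fixes G :: "'a::euclidean_space set"
  assumes "conic G"
  shows "span (G \<inter> sphere 0 1) = span G"
proof
  show "span (G \<inter> sphere 0 1) \<subseteq> span G"
    by (simp add: span_mono)
  have "x \<in> span (G \<inter> sphere 0 1)" if "x \<in> G" for x
  proof (cases "x = 0")
    case False
    with assms that have "x /\<^sub>R norm x \<in> G \<inter> sphere 0 1"
      by (rule conic_normalize)
    then have "norm x *\<^sub>R (x /\<^sub>R norm x) \<in> span (G \<inter> sphere 0 1)"
      by (intro span_mul span_base)
    with False show ?thesis by simp
  qed (simp add: span_zero)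
  then show "span G \<subseteq> span (G \<inter> sphere 0 1)"
    by (intro span_minimal) auto
qed

lemma isomorphic_face_lattices_vimage:
  fixes S :: "'b::euclidean_space \<Rightarrow> 'a::euclidean_space"
  assumes S: "linear S" "inj S" and K: "conic K" "0 \<in> K" "K \<subseteq> range S"
  shows "isomorphic_face_lattices (K \<inter> sphere 0 1) (S -` K \<inter> sphere 0 1)"
proof -
  have "conic (S -` K)" "0 \<in> S -` K"
    using conic_linear_vimage[OF S(1) K(1)] K(2) linear_0[OF S(1)] by simp_all
  then have pc: "polytope_cone (S -` K \<inter> sphere 0 1) = S -` K"
    "polytope_cone (K \<inter> sphere 0 1) = K"
    using K by (simp_all add: polytope_cone_conic)
  have SK: "S ` (S -` K) = K"
    using K(3) by auto
  have S0: "S y = 0 \<longleftrightarrow> y = 0" for y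
    using S by (metis injD linear_0)
  \<comment> \<open>\<open>S\<close> does not preserve the unit sphere, so it is followed by radial
    projection. Faces of a cone are conic, so on them this agrees with taking preimages of the
    cones.\<close>
  define \<phi> where "\<phi> F = {y \<in> sphere 0 1. S y /\<^sub>R norm (S y) \<in> F}" for F
  have \<phi>: "\<phi> (G \<inter> sphere 0 1) = S -` G \<inter> sphere 0 1" if "G face_of K" for G
  proof -
    have con: "conic G"
      using K(1) that by (rule face_of_conic)
    have "S y /\<^sub>R norm (S y) \<in> G \<longleftrightarrow> S y \<in> G" if "y \<noteq> 0" for y
    proof
      assume "S y /\<^sub>R norm (S y) \<in> G"
      from conicD[OF con this, of "norm (S y)"] that show "S y \<in> G"
        by (simp add: S0)
    next
      assume "S y \<in> G"
      then show "S y /\<^sub>R norm (S y) \<in> G"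
        using conicD[OF con, of "S y"] by simp
    qed
    moreover have "S y /\<^sub>R norm (S y) \<in> sphere 0 1" if "y \<noteq> 0" for y
      using that by (simp add: S0)
    moreover have "y \<noteq> 0" if "y \<in> sphere 0 1" for y :: 'b
      using that by auto
    ultimately have "y \<in> \<phi> (G \<inter> sphere 0 1) \<longleftrightarrow> y \<in> S -` G \<inter> sphere 0 1" for y
      unfolding \<phi>_def Int_iff mem_Collect_eq vimage_eq by metis
    then show ?thesis
      by (rule set_eqI)
  qed
  have face_iff: "S -` G face_of S -` K \<longleftrightarrow> G face_of K" if "G \<subseteq> K" for G
  proof -
    have "S ` (S -` G) = G"
      using that K(3) by auto
    then show ?thesis
      using face_of_linear_image[OF S, of "S -` G" "S -` K"] SK by simp
  qed
  have order: "F \<subseteq> F' \<longleftrightarrow> \<phi> F \<subseteq> \<phi> F'"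
    if F: "F \<in> spherical_faces (K \<inter> sphere 0 1)" for F F'
  proof
    show "F \<subseteq> F' \<Longrightarrow> \<phi> F \<subseteq> \<phi> F'"
      by (auto simp: \<phi>_def)
    assume le: "\<phi> F \<subseteq> \<phi> F'"
    show "F \<subseteq> F'"
    proof
      fix x assume x: "x \<in> F"
      have "F \<subseteq> K" "F \<subseteq> sphere 0 1"
        using F face_of_imp_subset by (auto simp: spherical_faces_def pc)
      with x K(3) have "x \<in> range S" "norm x = 1"
        by auto
      then obtain y where y: "x = S y" "norm x = 1"
        by blast
      then have "y \<noteq> 0"
        using S0[of y] by auto
      \<comment> \<open>\<open>S z\<close> is a positive multiple of the unit vector
        \<open>x\<close>, so radial projection returns \<open>x\<close>.\<close>
      define z where "z = y /\<^sub>R norm y"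
      have z: "S z /\<^sub>R norm (S z) = x" "z \<in> sphere 0 1"
        using y \<open>y \<noteq> 0\<close> S(1) by (simp_all add: z_def linear_cmul)
      with x have "z \<in> \<phi> F"
        unfolding \<phi>_def by blast
      with le have "z \<in> \<phi> F'"
        by blast
      with z(1) show "x \<in> F'"
        unfolding \<phi>_def by blast
    qed
  qed
  have "\<phi> ` spherical_faces (K \<inter> sphere 0 1) = spherical_faces (S -` K \<inter> sphere 0 1)"
  proof
    show "\<phi> ` spherical_faces (K \<inter> sphere 0 1) \<subseteq> spherical_faces (S -` K \<inter> sphere 0 1)"
    proof
      fix F assume "F \<in> \<phi> ` spherical_faces (K \<inter> sphere 0 1)"
      then obtain G where G: "G face_of K" "F = \<phi> (G \<inter> sphere 0 1)"
        by (auto simp: spherical_faces_def pc)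
      moreover have "S -` G face_of S -` K"
        using G(1) face_iff[OF face_of_imp_subset[OF G(1)]] by blast
      ultimately show "F \<in> spherical_faces (S -` K \<inter> sphere 0 1)"
        unfolding spherical_faces_def pc using \<phi>[OF G(1)] by blast
    qed
    show "spherical_faces (S -` K \<inter> sphere 0 1) \<subseteq> \<phi> ` spherical_faces (K \<inter> sphere 0 1)"
    proof
      fix F assume "F \<in> spherical_faces (S -` K \<inter> sphere 0 1)"
      then obtain G where G: "G face_of S -` K" "F = G \<inter> sphere 0 1"
        by (auto simp: spherical_faces_def pc)
      then have "S ` G face_of K"
        using face_of_linear_image[OF S, of G "S -` K"] SK by simp
      moreover from \<phi>[OF this] have "F = \<phi> (S ` G \<inter> sphere 0 1)"
        using S(2) G(2) by (simp add: inj_vimage_image_eq)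
      ultimately show "F \<in> \<phi> ` spherical_faces (K \<inter> sphere 0 1)"
        unfolding spherical_faces_def pc by blast
    qed
  qed
  moreover have "inj_on \<phi> (spherical_faces (K \<inter> sphere 0 1))"
  proof (rule inj_onI)
    fix F F' assume "F \<in> spherical_faces (K \<inter> sphere 0 1)"
      "F' \<in> spherical_faces (K \<inter> sphere 0 1)" "\<phi> F = \<phi> F'"
    then show "F = F'"
      using order[of F F'] order[of F' F] by simp
  qed
  ultimately have "bij_betw \<phi> (spherical_faces (K \<inter> sphere 0 1))
      (spherical_faces (S -` K \<inter> sphere 0 1))"
    by (simp add: bij_betw_def)
  then show ?thesis
    unfolding isomorphic_face_lattices_def
    by (intro exI[of _ \<phi>] conjI ballI order)
qed

section \<open>The cap in terms of the light cone\<close>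

lemma mem_cap_iff:
  fixes x :: "real \<times> (real^'d::finite)"
  shows "x \<in> cap \<longleftrightarrow> norm x = 1 \<and> 0 \<le> fst x \<and> norm (snd x) \<le> \<bar>fst x\<bar>"
proof -
  have "(\<Sum>k\<in>UNIV. (snd x $ k)\<^sup>2) = (norm (snd x))\<^sup>2"
    unfolding norm_vec_def L2_set_def by (simp add: sum_nonneg)
  moreover have "- (fst x)\<^sup>2 + (norm (snd x))\<^sup>2 \<le> 0 \<longleftrightarrow> norm (snd x) \<le> \<bar>fst x\<bar>"
    using abs_le_square_iff[of "norm (snd x)" "fst x"] by simp
  ultimately show ?thesis
    unfolding cap_def by simp
qed

text \<open>The strict inequality keeps the span off the whole cap, which contains its
  interior.\<close>

lemma weakly_avoidsI:
  fixes F :: "(real \<times> (real^'d::finite)) set"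
  assumes "\<And>x. x \<in> span F \<Longrightarrow> x \<noteq> 0 \<Longrightarrow> \<bar>fst x\<bar> < norm (snd x)"
  shows "weakly_avoids F"
proof -
  have "x \<notin> cap_interior" if "x \<in> spherical_span F" for x
  proof
    assume "x \<in> cap_interior"
    then have "norm x = 1" "norm (snd x) \<le> \<bar>fst x\<bar>"
      unfolding cap_interior_def Diff_iff mem_cap_iff by blast+
    moreover from this(1) have "x \<noteq> 0"
      by force
    ultimately show False
      using assms[of x] that by (simp add: spherical_span_def)
  qed
  then show ?thesis
    unfolding weakly_avoids_def by blast
qed

text \<open>A span is closed under negation and scaling, so a vector in either half of the light
  cone can be moved into the cap.\<close>

lemma weakly_cutsI:
  fixes F :: "(real \<times> (real^'d::finite)) set"
  assumes "x \<in> span F" "x \<noteq> 0" "norm (snd x) \<le> \<bar>fst x\<bar>"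
  shows "weakly_cuts F"
proof -
  define c where "c = (if fst x \<ge> 0 then inverse (norm x) else - inverse (norm x))"
  define y where "y = c *\<^sub>R x"
  have "fst y = inverse (norm x) * \<bar>fst x\<bar>" "norm (snd y) = inverse (norm x) * norm (snd x)"
    by (simp_all add: y_def c_def)
  then have "0 \<le> fst y" "norm (snd y) \<le> \<bar>fst y\<bar>"
    using assms(3) by (simp_all add: abs_mult mult_left_mono)
  moreover have "norm y = 1"
    using assms(2) by (simp add: y_def c_def)
  moreover have "y \<in> span F"
    unfolding y_def using assms(1) by (rule span_mul)
  ultimately have "y \<in> spherical_span F \<inter> cap"
    unfolding spherical_span_def Int_iff mem_cap_iff by simp
  then show ?thesis
    unfolding weakly_cuts_def by blast
qed

section \<open>The realization as a linear image of the given cone\<close>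

theorem theorem7:
  fixes P :: "'a::euclidean_space set" and i j :: nat
  assumes "i < j" and "j \<le> CARD('d::finite) - 1"
    and "spherical_d_polytope CARD('d) P"
  shows "weakly_scribable TYPE('d) i j P"
proof -
  obtain A where A: "finite A" "P = {x. \<forall>a\<in>A. 0 \<le> a \<bullet> x} \<inter> sphere 0 1"
    and pointed: "\<forall>x\<in>P. - x \<notin> P" and dim: "dim (polytope_cone P) = CARD('d) + 1"
    using assms(3) unfolding spherical_d_polytope_def spherical_polytope_iff by blast
  define K where "K = {x. \<forall>a\<in>A. 0 \<le> a \<bullet> x}"
  have K: "conic K" "0 \<in> K" "P = K \<inter> sphere 0 1"
    using A(2) by (simp_all add: K_def conic_halfspaces)
  then have pcP: "polytope_cone P = K"
    by (simp add: polytope_cone_conic)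
  have "K = \<Inter>((\<lambda>a. {x. 0 \<le> a \<bullet> x}) ` A)"
    by (auto simp: K_def)
  then have "polyhedron K"
    using A(1) by (auto intro!: polyhedron_Inter polyhedron_halfspace_ge)
  define V where "V = span K"
  \<comment> \<open>\<open>K\<close> is itself a face, so \<open>V\<close> belongs to this finite
    family.\<close>
  define \<L> where "\<L> = span ` {G. G face_of K}"
  have fin: "finite \<L>"
    unfolding \<L>_def using finite_polyhedron_faces[OF \<open>polyhedron K\<close>] by simp
  have sub: "subspace L" if "L \<in> \<L>" for L
    using that by (auto simp: \<L>_def)
  have "V \<in> \<L>"
    unfolding V_def \<L>_def
    using face_of_refl[OF polyhedron_imp_convex[OF \<open>polyhedron K\<close>]] by blast
  have "dim V = CARD('d) + 1"
    using dim by (simp add: V_def pcP)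
  have "j \<le> CARD('d)"
    using assms(2) by linarith
  obtain T :: "'a \<Rightarrow> real \<times> (real^'d)" where T: "linear T" "inj_on T V"
    and avoid: "\<forall>L\<in>\<L>. dim L \<le> j \<longrightarrow> (\<forall>x\<in>L. x \<noteq> 0 \<longrightarrow> \<bar>fst (T x)\<bar> < norm (snd (T x)))"
    and cut: "\<forall>L\<in>\<L>. j < dim L \<longrightarrow> (\<exists>x\<in>L. x \<noteq> 0 \<and> norm (snd (T x)) \<le> \<bar>fst (T x)\<bar>)"
    by (rule exists_linear_map_separating_dimensions[OF fin sub \<open>V \<in> \<L>\<close> \<open>dim V = _\<close>
        \<open>j \<le> CARD('d)\<close>])
  have subV: "subspace V"
    by (simp add: V_def)
  then have "span V = V"
    by (rule span_eq_iff[THEN iffD2])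
  \<comment> \<open>The ambient space of \<open>P\<close> may exceed \<open>V\<close>, so
    \<open>T\<close> is inverted on \<open>V\<close> only; equality of dimensions makes it
    onto.\<close>
  have "dim (T ` V) = DIM(real \<times> (real^'d))"
    using dim_image_eq[OF T(1), of V, unfolded \<open>span V = V\<close>] T(2) \<open>dim V = _\<close> by simp
  then have "span (T ` V) = UNIV"
    by (rule dim_eq_full[THEN iffD1])
  moreover have "span (T ` V) = T ` V"
    using linear_subspace_image[OF T(1) subV] by (rule span_eq_iff[THEN iffD2])
  ultimately have TV: "T ` V = UNIV"
    by (rule back_subst[where P = "\<lambda>X. X = UNIV"])
  obtain S where S: "range S \<subseteq> V" "linear S" "\<And>v. v \<in> V \<Longrightarrow> S (T v) = v"
    using linear_exists_left_inverse_on[OF T(1) subV T(2)] by blast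
  have TS: "T (S y) = y" for y
  proof -
    have "y \<in> T ` V"
      by (simp add: TV)
    then show ?thesis
      using S(3) by auto
  qed
  then have "inj S"
    by (rule inj_on_inverseI)
  have "V \<subseteq> range S"
    using S(3) by (metis rangeI subsetI)
  then have "K \<subseteq> range S"
    using span_superset unfolding V_def by blast
  \<comment> \<open>This is the image of \<open>K\<close> under \<open>T\<close>, written as a
    preimage under its inverse \<open>S\<close>.\<close>
  define K' where "K' = S -` K"
  define Q where "Q = K' \<inter> sphere 0 1"
  have SK': "S ` K' = K"
    using \<open>K \<subseteq> range S\<close> by (auto simp: K'_def)
  have S0: "S y = 0 \<longleftrightarrow> y = 0" for y
    using S(2) \<open>inj S\<close> by (metis injD linear_0)
  have K': "conic K'" "0 \<in> K'"
    unfolding K'_def using K S(2) by (simp_all add: conic_linear_vimage linear_0)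
  then have pcQ: "polytope_cone Q = K'"
    unfolding Q_def by (rule polytope_cone_conic)
  have dim_S: "dim (S ` G) = dim G" for G
    using S(2) inj_on_subset[OF \<open>inj S\<close> subset_UNIV] by (rule dim_image_eq)
  have "spherical_polytope Q"
    unfolding spherical_polytope_iff
  proof safe
    have "K' = {y. \<forall>b\<in>adjoint S ` A. 0 \<le> b \<bullet> y}"
      using adjoint_works[OF S(2)] by (auto simp: K'_def K_def inner_commute)
    with A(1) show "\<exists>B. finite B \<and> Q = {x. \<forall>a\<in>B. 0 \<le> a \<bullet> x} \<inter> sphere 0 1"
      unfolding Q_def by blast
  next
    fix y assume "y \<in> Q" "- y \<in> Q"
    then have "S y \<in> K" "- S y \<in> K" "S y \<noteq> 0"
      using S(2) S0[of y] by (auto simp: Q_def K'_def linear_neg)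
    then have "S y /\<^sub>R norm (S y) \<in> P" "- (S y /\<^sub>R norm (S y)) \<in> P"
      using conic_normalize[OF K(1), of "S y"] conic_normalize[OF K(1), of "- S y"] K(3)
      by simp_all
    with pointed show False by blast
  qed
  moreover have "dim K' = CARD('d) + 1"
    using dim dim_S[of K'] by (simp add: SK' pcP)
  ultimately have "spherical_d_polytope CARD('d) Q"
    by (simp add: spherical_d_polytope_def pcQ)
  moreover have "isomorphic_face_lattices P Q"
    unfolding K(3) Q_def K'_def using S(2) \<open>inj S\<close> K(1,2) \<open>K \<subseteq> range S\<close>
    by (rule isomorphic_face_lattices_vimage)
  moreover have "weakly_scribed i j Q"
  proof -
    \<comment> \<open>Spans of faces of \<open>K'\<close> are carried by \<open>S\<close> onto spans
      of faces of \<open>K\<close> of the same dimension, to which the choice of \<open>T\<close>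
      applies.\<close>
    have face: "conic G \<and> S ` span G \<in> \<L> \<and> dim (S ` span G) = dim G" if "G face_of K'" for G
    proof -
      have "S ` G face_of K"
        using face_of_linear_image[OF S(2) \<open>inj S\<close>, of G K'] that by (simp add: SK')
      then have "S ` span G \<in> \<L>"
        using linear_span_image[OF S(2), of G] by (auto simp: \<L>_def)
      with face_of_conic[OF K'(1) that] show ?thesis
        by (simp add: dim_S)
    qed
    have "weakly_avoids F" if F: "k_face i F Q" for F
    proof (rule weakly_avoidsI)
      fix y assume y: "y \<in> span F" "y \<noteq> 0"
      obtain G where G: "G face_of K'" "dim G = i + 1" "F = G \<inter> sphere 0 1"
        using F unfolding k_face_def pcQ by blast
      have "y \<in> span G"
        using y(1) face[OF G(1)] by (simp add: G(3) span_conic_Int_sphere)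
      \<comment> \<open>Here \<open>i < j\<close> enters: the linear dimension \<open>i + 1\<close>
        does not exceed the threshold \<open>j\<close>, while for a \<open>j\<close>-face it is
        \<open>j + 1\<close>.\<close>
      then have "S y \<in> S ` span G" "S y \<noteq> 0" "dim (S ` span G) \<le> j"
        using face[OF G(1)] G(2) assms(1) y(2) by (simp_all add: S0)
      then have "\<bar>fst (T (S y))\<bar> < norm (snd (T (S y)))"
        using face[OF G(1)] avoid by blast
      then show "\<bar>fst y\<bar> < norm (snd y)"
        by (simp add: TS)
    qed
    moreover have "weakly_cuts F" if F: "k_face j F Q" for F
    proof -
      obtain G where G: "G face_of K'" "dim G = j + 1" "F = G \<inter> sphere 0 1"
        using F unfolding k_face_def pcQ by blast
      then obtain x where "x \<in> S ` span G" "x \<noteq> 0" "norm (snd (T x)) \<le> \<bar>fst (T x)\<bar>"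
        using cut face[OF G(1)] by fastforce
      then obtain y where "y \<in> span G" "y \<noteq> 0" "norm (snd y) \<le> \<bar>fst y\<bar>"
        by (auto simp: S0 TS)
      then show ?thesis
        using face[OF G(1)] by (intro weakly_cutsI[of y]) (simp_all add: G(3) span_conic_Int_sphere)
    qed
    ultimately show ?thesis
      by (simp add: weakly_scribed_def)
  qed
  ultimately show ?thesis
    by (auto simp: weakly_scribable_def realization_def)
qed

end
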